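(* Let $\alpha\in(0,2)$ and suppose that $M\colon\mathbb{R}_+\to(0,\infty)$ is a regularly varying function of index $\alpha$. Then there exists a positive Radon measure $\nu$ on $\mathbb{R}_+$ with $\nu([0,1))=0$ such that the function $k$ defined by $$k(t)=\int_{\mathbb{R}_+}e^{-\tau t}\,\mathrm{d}\nu(\tau),\quad t>0,$$ takes values in $(0,\infty)$, is integrable over $(0,\infty)$ and satisfies $\operatorname{Re}\mathcal{F}k(s)\sim 1/M(s)$ as $s\to\infty$.
   Context: $\mathbb{R}_+=[0,\infty)$. A measurable function $M\colon[a,\infty)\to(0,\infty)$, $a\ge0$, is regularly varying of index $\alpha\in\mathbb{R}$ if $\lim_{s\to\infty}M(\lambda s)/M(s)=\lambda^\alpha$ for all $\lambda\ge1$. $k$ is extended by zero to $(-\infty,0)$ and $\mathcal{F}k(s)=\int_{\mathbb{R}}e^{-ist}k(t)\,\mathrm{d}t$, $s\in\mathbb{R}$. $f(s)\sim g(s)$ as $s\to\infty$ means $f(s)/g(s)\to1$ as $s\to\infty$. *)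

theory Defs
  imports "HOL-Analysis.Analysis" "HOL-Library.Landau_Symbols"
begin

text \<open>Measurable means Lebesgue measurable, which includes the Borel case; only the
  restriction of \<open>M\<close> to \<open>{a..}\<close> matters.\<close>

definition regularly_varying :: "real \<Rightarrow> real \<Rightarrow> (real \<Rightarrow> real) \<Rightarrow> bool" where
  "regularly_varying a \<alpha> M \<longleftrightarrow>
     0 \<le> a \<and>
     M \<in> borel_measurable (lebesgue_on {a..}) \<and>
     (\<forall>s\<ge>a. 0 < M s) \<and>
     (\<forall>c\<ge>1. ((\<lambda>s. M (c * s) / M s) \<longlongrightarrow> c powr \<alpha>) at_top)"

text \<open>Finiteness on compact sets is the usual local finiteness when \<open>X\<close> is locally compact.\<close>

definition radon_measure_on :: "'a::t2_space set \<Rightarrow> 'a measure \<Rightarrow> bool" where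
  "radon_measure_on X \<nu> \<longleftrightarrow>
     sets \<nu> = sets (restrict_space borel X) \<and>
     (\<forall>K. K \<subseteq> X \<longrightarrow> compact K \<longrightarrow> emeasure \<nu> K < \<infinity>) \<and>
     (\<forall>A\<in>sets \<nu>. emeasure \<nu> A = (SUP K\<in>{K. K \<subseteq> A \<and> compact K}. emeasure \<nu> K))"

text \<open>The Bochner integral is \<open>0\<close> when the integrand is not integrable, so finiteness of
  the transform has to be stated separately.\<close>

definition laplace_transform :: "real measure \<Rightarrow> real \<Rightarrow> real" where
  "laplace_transform \<nu> t = (LINT \<tau>|\<nu>. exp (- (\<tau> * t)))"

definition fourier_transform :: "(real \<Rightarrow> real) \<Rightarrow> real \<Rightarrow> complex" where
  "fourier_transform k s =
     (LINT t|lborel. exp (- (\<i> * complex_of_real (s * t))) * complex_of_real (k t))"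

end

(* With G(s) = M(s) / s^alpha slowly varying, the measure is the density 1 / (I * M) on [X, infinity),
   X large.  By Fubini, Re F k(s) is the integral of tau / (tau^2 + s^2) against nu, and
   tau = s * u turns M(s) * Re F k(s) into (1 / I) times the integral over u > 0 of
   u / (1 + u^2) * M(s) / M(s u), which converges to 1 when I is the integral of
   u^(1 - alpha) / (1 + u^2).  Dominated convergence applies thanks to Potter's bounds for G; these need
   a local bound on the ratios G(u s) / G(s), which measurability supplies through
   a Steinhaus-type argument. *)
theory Submission
  imports Defs
begin

section \<open>Potter's bounds\<close>

text \<open>The range of \<alpha> is what makes I finite: u^(1 - \<alpha>) / (1 + u^2) is integrable
  at 0 because \<alpha> < 2 and at infinity because \<alpha> > 0. Both conditions are strict, so
  they leave room for the small change of exponent that Potter's bounds introduce. On bounded sets 1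
  / M need be neither bounded nor integrable, hence the cutoff at X. For fixed u > 0 the cutoff is
  invisible once s u >= X, so the limit does not see it. Integrability of k amounts to finiteness of
  the integral of 1 / \<tau> against \<nu>, which follows because M grows at least like a positive
  power. The obstacle that shapes the formal proof is measurability: M is only Lebesgue measurable,
  while \<nu> is a Borel measure. The ratios of G are therefore studied with Lebesgue measure, and a
  Borel function that agrees almost everywhere with the intended density carries \<nu>.\<close>

lemma borel_measurable_lebesgue_scale:
  fixes f :: "real \<Rightarrow> 'b::topological_space"
  assumes "f \<in> borel_measurable lebesgue"
  shows "(\<lambda>x. f (c * x)) \<in> borel_measurable lebesgue"
  using measurable_compose[OF lebesgue_measurable_scaling[of c] assms] by simp

text \<open>The hypothesis is pointwise in c, the conclusion uniform in u. By dominated convergence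
  the set of factors w in [1, 4] that are bad for t has measure below 1/2 for all large t. Hence the
  w bad for u s and the w with u w bad for s cannot together cover [1, 2], which has measure 1. A
  common good w exhibits G (u s) / G s as a quotient of two numbers in [1/2, 2], whence the bounds
  1/4 and 4.\<close>

lemma slowly_varying_locally_bounded:
  fixes G :: "real \<Rightarrow> real"
  assumes G[measurable]: "G \<in> borel_measurable lebesgue"
    and pos: "\<And>x. 0 < G x"
    and lim: "\<And>c. 1 \<le> c \<Longrightarrow> ((\<lambda>s. G (c * s) / G s) \<longlongrightarrow> 1) at_top"
  shows "\<exists>X\<ge>1. \<forall>s\<ge>X. \<forall>u\<in>{1..2}. G (u * s) / G s \<in> {1/4..4}"
proof -
  define bad where "bad t w \<longleftrightarrow> G (w * t) / G t \<notin> {1/2..2}" for t w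
  \<comment> \<open>The indicator of the bad factors, so that its integral is their measure. The
    window reaches 4 because it has to contain every product of two factors from [1, 2].\<close>
  define h :: "real \<Rightarrow> real \<Rightarrow> real" where "h t w = (if w \<in> {1..4} \<and> bad t w then 1 else 0)" for t w
  have Gt[measurable]: "(\<lambda>w. G (w * t)) \<in> borel_measurable lebesgue" for t
    using borel_measurable_lebesgue_scale[OF G, of t] by (simp add: mult.commute)
  have h_meas[measurable]: "h t \<in> borel_measurable lebesgue" for t
  proof -
    have "{w \<in> space lebesgue. w \<in> {1..4} \<and> bad t w} =
        {1..4} \<inter> ((\<lambda>w. G (w * t) / G t) -` (- {1/2..2}) \<inter> space lebesgue)"
      by (auto simp: bad_def)
    also have "\<dots> \<in> sets lebesgue"
      by (intro sets.Int measurable_sets[of _ _ borel]) auto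
    finally have "{w \<in> space lebesgue. w \<in> {1..4} \<and> bad t w} \<in> sets lebesgue" .
    then show ?thesis unfolding h_def by (intro measurable_If) auto
  qed
  have int_ind: "integrable lebesgue (indicator {1..4::real} :: real \<Rightarrow> real)"
    by (subst integrable_completion) auto
  have "((\<lambda>t. integral\<^sup>L lebesgue (h t)) \<longlongrightarrow> integral\<^sup>L lebesgue (\<lambda>_::real. 0)) at_top"
  proof (rule integral_dominated_convergence_at_top[where w="indicator {1..4}"])
    show "AE w in lebesgue. ((\<lambda>t. h t w) \<longlongrightarrow> 0) at_top"
    proof (rule AE_I2)
      fix w :: real
      show "((\<lambda>t. h t w) \<longlongrightarrow> 0) at_top"
      proof (cases "w \<in> {1..4}")
        case True
        then have l: "((\<lambda>s. G (w * s) / G s) \<longlongrightarrow> 1) at_top" using lim by auto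
        have "\<forall>\<^sub>F t in at_top. h t w = 0"
          using order_tendstoD(1)[OF l, of "1/2", simplified] order_tendstoD(2)[OF l, of 2, simplified]
          by eventually_elim (auto simp: h_def bad_def)
        then show ?thesis by (rule tendsto_eventually)
      qed (auto simp: h_def)
    qed
  qed (auto simp: int_ind h_def intro!: always_eventually)
  then have "\<forall>\<^sub>F t in at_top. integral\<^sup>L lebesgue (h t) < 1/2"
    by (intro order_tendstoD(2)[where y=0]) simp_all
  then obtain X0 where X0: "\<And>t. t \<ge> X0 \<Longrightarrow> integral\<^sup>L lebesgue (h t) < 1/2"
    by (auto simp: eventually_at_top_linorder)
  have int_h: "integrable lebesgue (h t)" for t
    by (rule Bochner_Integration.integrable_bound[OF int_ind]) (auto simp: h_def)
  have nn: "(\<integral>\<^sup>+w. ennreal (h t w) \<partial>lebesgue) < ennreal (1/2)" if "t \<ge> X0" for t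
  proof -
    have "(\<integral>\<^sup>+w. ennreal (h t w) \<partial>lebesgue) = ennreal (integral\<^sup>L lebesgue (h t))"
      by (rule nn_integral_eq_integral[OF int_h]) (auto simp: h_def)
    also have "\<dots> < ennreal (1/2)" by (rule ennreal_lessI[OF _ X0[OF that]]) simp
    finally show ?thesis .
  qed
  have "G (u * s) / G s \<in> {1/4..4}" if s: "s \<ge> max X0 1" and u: "u \<in> {1..2}" for s u
  proof -
    have "1 * s \<le> u * s" using s u by (intro mult_right_mono) auto
    moreover have "X0 \<le> 1 * s" using s by simp
    ultimately have us: "u * s \<ge> X0" by (rule order_trans[rotated])
    \<comment> \<open>At such a \<open>w\<close> the ratio \<open>G (u * s) / G s\<close> is a quotient of two controlled ratios.\<close>
    have "\<exists>w\<in>{1..2}. \<not> bad (u * s) w \<and> \<not> bad s (u * w)"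
    proof (rule ccontr)
      assume "\<not> ?thesis"
      then have cover: "indicator {1..2} w \<le> ennreal (h (u * s) w) + ennreal (h s (u * w))" for w :: real
        using u mult_mono[of 1 u 1 w] mult_mono[of u 2 w 2]
        by (cases "w \<in> {1..2}") (auto simp: h_def)
      have [measurable]: "(\<lambda>w. h s (u * w)) \<in> borel_measurable lebesgue"
        by (rule borel_measurable_lebesgue_scale[OF h_meas])
      \<comment> \<open>Pulling the bad set of s back along w |-> u w divides its measure by u >= 1,
        so the bound 1/2 survives.\<close>
      have "1 * (\<integral>\<^sup>+w. ennreal (h s (u * w)) \<partial>lebesgue) \<le> ennreal \<bar>u\<bar> * (\<integral>\<^sup>+w. ennreal (h s (u * w)) \<partial>lebesgue)"
        using u by (intro mult_right_mono) auto
      also have "\<dots> = (\<integral>\<^sup>+w. ennreal (h s w) \<partial>lebesgue)"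
        using u nn_integral_real_affine_lebesgue[of "\<lambda>w. ennreal (h s w)" u 0] by simp
      also have "\<dots> < ennreal (1/2)" using nn s by simp
      finally have 2: "(\<integral>\<^sup>+w. ennreal (h s (u * w)) \<partial>lebesgue) < ennreal (1/2)" by simp
      have "(1::ennreal) = emeasure lebesgue {1..2::real}" by simp
      also have "\<dots> = (\<integral>\<^sup>+w. indicator {1..2::real} w \<partial>lebesgue)"
        by (subst nn_integral_indicator) auto
      also have "\<dots> \<le> (\<integral>\<^sup>+w. ennreal (h (u * s) w) + ennreal (h s (u * w)) \<partial>lebesgue)"
        by (intro nn_integral_mono cover)
      also have "\<dots> = (\<integral>\<^sup>+w. ennreal (h (u * s) w) \<partial>lebesgue) + (\<integral>\<^sup>+w. ennreal (h s (u * w)) \<partial>lebesgue)"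
        by (rule nn_integral_add) auto
      also have "\<dots> < ennreal (1/2) + ennreal (1/2)"
        by (rule add_strict_mono[OF nn[OF us] 2])
      also have "\<dots> = 1" by (subst ennreal_plus[symmetric]) simp_all
      finally show False by simp
    qed
    then obtain w where w: "G (w * (u * s)) / G (u * s) \<in> {1/2..2}" "G (u * w * s) / G s \<in> {1/2..2}"
      unfolding bad_def by auto
    have e: "G (u * s) / G s = (G (u * w * s) / G s) / (G (w * (u * s)) / G (u * s))"
      using pos[of "w * (u * s)"] pos[of "u * s"] by (simp add: mult_ac)
    have "a / b \<in> {1/4..4}" if "a \<in> {1/2..2}" "b \<in> {1/2..2}" for a b :: real
      using that by (auto simp: field_simps)
    from this[OF w(2,1)] show ?thesis unfolding e .
  qed
  then show ?thesis by (intro exI[of _ "max X0 1"]) auto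
qed

text \<open>Since 1 lies strictly between 2 powr (-\<epsilon>) and 2 powr \<epsilon>, each doubling
  of the argument eventually costs at most a factor 2 powr \<epsilon>, exactly the growth of u powr
  \<epsilon>. The constant 4 is paid once, for the remaining factor in [1, 2], by local
  boundedness.\<close>

lemma potter_bounds:
  fixes G :: "real \<Rightarrow> real"
  assumes "G \<in> borel_measurable lebesgue"
    and pos: "\<And>x. 0 < G x"
    and lim: "\<And>c. 1 \<le> c \<Longrightarrow> ((\<lambda>s. G (c * s) / G s) \<longlongrightarrow> 1) at_top"
    and \<epsilon>: "0 < \<epsilon>"
  shows "\<exists>X\<ge>1. \<forall>s\<ge>X. \<forall>u\<ge>1. G (u * s) / G s \<le> 4 * u powr \<epsilon> \<and> G s / G (u * s) \<le> 4 * u powr \<epsilon>"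
proof -
  obtain X1 where X1: "X1 \<ge> 1" "\<And>s u. s \<ge> X1 \<Longrightarrow> u \<in> {1..2} \<Longrightarrow> G (u * s) / G s \<in> {1/4..4}"
    using slowly_varying_locally_bounded[OF assms(1) pos lim] by blast
  have b: "2 powr \<epsilon> > 1" "2 powr (-\<epsilon>) < 1" using \<epsilon> by (auto simp: powr_less_one)
  have l: "((\<lambda>s. G (2 * s) / G s) \<longlongrightarrow> 1) at_top" by (rule lim) auto
  have "\<forall>\<^sub>F s in at_top. 2 powr (-\<epsilon>) < G (2 * s) / G s \<and> G (2 * s) / G s < 2 powr \<epsilon>"
    using order_tendstoD(1)[OF l b(2)] order_tendstoD(2)[OF l b(1)] by eventually_elim auto
  then obtain X2 where X2: "\<And>s. s \<ge> X2 \<Longrightarrow> 2 powr (-\<epsilon>) < G (2 * s) / G s \<and> G (2 * s) / G s < 2 powr \<epsilon>"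
    by (auto simp: eventually_at_top_linorder)
  define X where "X = max X1 X2"
  have dbl: "G (2 * s) \<le> 2 powr \<epsilon> * G s" "G s \<le> 2 powr \<epsilon> * G (2 * s)" if "s \<ge> X" for s
    using X2[of s] that pos[of s] by (auto simp: X_def field_simps powr_minus)
  have loc: "G (u * s) \<le> 4 * G s" "G s \<le> 4 * G (u * s)" if "s \<ge> X" "u \<in> {1..2}" for s u
    using X1(2)[of s u] that pos[of s] by (auto simp: X_def field_simps)
  have dyadic: "G (u * s) \<le> 4 * u powr \<epsilon> * G s \<and> G s \<le> 4 * u powr \<epsilon> * G (u * s)"
    if "s \<ge> X" "1 \<le> u" "u \<le> 2 ^ Suc n" for n s u
    using that
  proof (induction n arbitrary: s u)
    case 0
    have "1 * 1 \<le> u powr \<epsilon>" using \<epsilon> 0 by (auto intro: ge_one_powr_ge_zero)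
    then have "4 * G t \<le> 4 * u powr \<epsilon> * G t" for t
      using pos[of t] by (auto intro!: mult_right_mono)
    moreover have "u \<in> {1..2}" using 0 by simp
    ultimately show ?case using loc[OF \<open>X \<le> s\<close>] by (meson order_trans)
  next
    case (Suc n)
    show ?case
    proof (cases "u \<le> 2")
      case True
      then have "u \<le> 2 ^ Suc n" using one_le_power[of "2::real" n] by (simp add: order_trans[of u 2])
      with Suc show ?thesis by blast
    next
      case False
      have X1': "X \<ge> 1" using X1 by (auto simp: X_def)
      \<comment> \<open>The factor 2 moves into the base point: u s = (u/2) (2 s), and 2 s is again
        at least X. This is why the induction generalizes over s.\<close>
      have ih: "G (u/2 * (2 * s)) \<le> 4 * (u/2) powr \<epsilon> * G (2 * s) \<and> G (2 * s) \<le> 4 * (u/2) powr \<epsilon> * G (u/2 * (2 * s))"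
        using Suc.prems False X1' by (intro Suc.IH) auto
      have p: "u powr \<epsilon> = (u/2) powr \<epsilon> * 2 powr \<epsilon>" using False by (simp add: powr_divide)
      have "G (u * s) \<le> 4 * (u/2) powr \<epsilon> * G (2 * s)" using ih by simp
      also have "\<dots> \<le> 4 * (u/2) powr \<epsilon> * (2 powr \<epsilon> * G s)"
        by (intro mult_left_mono dbl Suc.prems) auto
      finally have 1: "G (u * s) \<le> 4 * u powr \<epsilon> * G s" by (simp add: p)
      have "G s \<le> 2 powr \<epsilon> * G (2 * s)" by (intro dbl Suc.prems)
      also have "\<dots> \<le> 2 powr \<epsilon> * (4 * (u/2) powr \<epsilon> * G (u/2 * (2 * s)))"
        using ih by (intro mult_left_mono) auto
      finally have "G s \<le> 4 * u powr \<epsilon> * G (u * s)" by (simp add: p mult_ac)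
      with 1 show ?thesis by blast
    qed
  qed
  have "G (u * s) / G s \<le> 4 * u powr \<epsilon> \<and> G s / G (u * s) \<le> 4 * u powr \<epsilon>" if "s \<ge> X" "u \<ge> 1" for s u
  proof -
    obtain n where "u < 2 ^ n" using real_arch_pow[of 2 u] by auto
    also have "(2::real) ^ n \<le> 2 ^ Suc n" by simp
    finally show ?thesis
      using dyadic[of s u n] that pos[of s] pos[of "u * s"] by (auto simp: pos_divide_le_eq)
  qed
  then show ?thesis using X1 by (intro exI[of _ X]) (auto simp: X_def)
qed

section \<open>Integrals of exponentials and powers, and the Laplace transform of the cosine\<close>

lemma integrable_exp_minus_atLeast:
  fixes \<tau> c :: real
  assumes "0 < \<tau>"
  shows "integrable lborel (\<lambda>t. indicator {c..} t * exp (- (\<tau> * t)))"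
proof -
  have "(\<lambda>t. exp (- \<tau> * t)) absolutely_integrable_on {c..}"
    using has_integral_exp_minus_to_infinity[OF assms]
    by (intro nonnegative_absolutely_integrable_1) (auto simp: has_integral_iff)
  then show ?thesis
    unfolding set_integrable_def by (subst (asm) integrable_completion) auto
qed

lemma integrable_powr_atLeast:
  fixes a :: real
  assumes "a < -1"
  shows "integrable lborel (\<lambda>x. indicator {1..} x * x powr a)"
proof -
  have "(\<lambda>x. x powr a) absolutely_integrable_on {1..}"
    using has_integral_powr_to_inf[OF assms, of 1]
    by (intro nonnegative_absolutely_integrable_1) (auto simp: has_integral_iff)
  then show ?thesis
    unfolding set_integrable_def by (subst (asm) integrable_completion) auto
qed

lemma integrable_powr_Ioc:
  fixes a :: real
  assumes "-1 < a"
  shows "integrable lborel (\<lambda>x. indicator {0<..1} x * x powr a)"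
proof -
  have "(\<lambda>x. x powr a) absolutely_integrable_on {0<..1}"
    using integrable_on_powr_from_0'[OF assms, of 1]
    by (intro nonnegative_absolutely_integrable_1) auto
  then show ?thesis
    unfolding set_integrable_def by (subst (asm) integrable_completion) auto
qed

text \<open>The value is the real part of 1 / (\<tau> + i s). The case s = 0, with value 1 / \<tau>,
  serves later as the integral of the dominating exponential.\<close>

lemma has_bochner_integral_exp_cos:
  fixes \<tau> s :: real
  assumes "0 < \<tau>"
  shows "has_bochner_integral lborel
    (\<lambda>t. indicator {0<..} t * (exp (- (\<tau> * t)) * cos (s * t))) (\<tau> / (\<tau>\<^sup>2 + s\<^sup>2))"
proof -
  have int: "integrable lborel (\<lambda>t. indicator {0<..} t * (exp (- (\<tau> * t)) * cos (s * t)))"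
    by (rule Bochner_Integration.integrable_bound[OF integrable_exp_minus_atLeast[OF assms, of 0]])
       (auto simp: indicator_def abs_mult mult_left_le)
  \<comment> \<open>The real part of the complex antiderivative - exp (- (\<tau> + i s) t) / (\<tau>
    + i s).\<close>
  define F where "F t = exp (- (\<tau> * t)) * (s * sin (s * t) - \<tau> * cos (s * t)) / (\<tau>\<^sup>2 + s\<^sup>2)" for t
  have pos: "\<tau>\<^sup>2 + s\<^sup>2 > 0" using assms by (simp add: add_pos_nonneg)
  have deriv: "(F has_vector_derivative exp (- (\<tau> * t)) * cos (s * t)) (at t)" for t
  proof -
    have "((\<lambda>t. exp (- (\<tau> * t)) * (s * sin (s * t) - \<tau> * cos (s * t))) has_real_derivative
        exp (- (\<tau> * t)) * cos (s * t) * (\<tau>\<^sup>2 + s\<^sup>2)) (at t)"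
      by (auto intro!: derivative_eq_intros simp: algebra_simps power2_eq_square)
    from DERIV_cdivide[OF this, of "\<tau>\<^sup>2 + s\<^sup>2"] show ?thesis
      using assms unfolding F_def has_real_derivative_iff_has_vector_derivative[symmetric] by simp
  qed
  have bdd: "norm (F t) \<le> exp (- (\<tau> * t)) * ((\<bar>s\<bar> + \<tau>) / (\<tau>\<^sup>2 + s\<^sup>2))" for t
  proof -
    have "\<bar>s * sin (s * t) - \<tau> * cos (s * t)\<bar> \<le> \<bar>s * sin (s * t)\<bar> + \<bar>\<tau> * cos (s * t)\<bar>"
      by (rule abs_triangle_ineq4)
    also have "\<dots> \<le> \<bar>s\<bar> + \<tau>"
      using assms by (intro add_mono) (auto simp: abs_mult mult_left_le)
    finally show ?thesis using pos
      by (auto simp: F_def abs_mult divide_right_mono)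
  qed
  have "filterlim (\<lambda>t. - (\<tau> * t)) at_bot at_top"
    using filterlim_tendsto_pos_mult_at_top[OF tendsto_const assms filterlim_ident]
    by (simp add: filterlim_uminus_at_bot)
  then have "((\<lambda>t. exp (- (\<tau> * t)) * ((\<bar>s\<bar> + \<tau>) / (\<tau>\<^sup>2 + s\<^sup>2))) \<longlongrightarrow> 0) at_top"
    by (intro tendsto_mult_left_zero filterlim_compose[OF exp_at_bot])
  then have lim: "(F \<longlongrightarrow> 0) at_top"
    by (rule Lim_null_comparison[OF always_eventually[OF allI[OF bdd]]])
  have "(LBINT t=0..\<infinity>. exp (- (\<tau> * t)) * cos (s * t)) = 0 - F 0"
  proof (rule interval_integral_FTC_integrable[OF _ deriv])
    show "set_integrable lborel (einterval 0 \<infinity>) (\<lambda>t. exp (- (\<tau> * t)) * cos (s * t))"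
      using int by (simp add: set_integrable_def zero_ereal_def)
    have "(F \<longlongrightarrow> F 0) (at_right 0)"
      using has_vector_derivative_continuous[OF deriv[of 0]]
      by (simp add: isCont_def filterlim_at_split)
    then show "((F \<circ> real_of_ereal) \<longlongrightarrow> F 0) (at_right 0)"
      by (simp add: zero_ereal_def ereal_tendsto_simps)
    show "((F \<circ> real_of_ereal) \<longlongrightarrow> 0) (at_left \<infinity>)"
      using lim by (simp add: ereal_tendsto_simps)
  qed (auto intro!: continuous_intros)
  then have "(LINT t|lborel. indicator {0<..} t * (exp (- (\<tau> * t)) * cos (s * t))) = \<tau> / (\<tau>\<^sup>2 + s\<^sup>2)"
    by (simp add: F_def interval_lebesgue_integral_def set_lebesgue_integral_def zero_ereal_def)
  with int show ?thesis by (simp add: has_bochner_integral_iff)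
qed

section \<open>Transforms of measures with a decaying density\<close>

text \<open>This isolates what can be shown without regular variation: any positive rate of decay at
  infinity, together with vanishing below 1, yields a Radon measure, an integrable k and the formula
  for the real part of its Fourier transform.\<close>

locale decaying_density =
  fixes f :: "real \<Rightarrow> real" and D \<delta> :: real
  assumes borel [measurable]: "f \<in> borel_measurable borel"
    and nonneg: "0 \<le> f \<tau>"
    and zero: "\<tau> < 1 \<Longrightarrow> f \<tau> = 0"
    and bound: "1 \<le> \<tau> \<Longrightarrow> f \<tau> \<le> D * \<tau> powr (-\<delta>)"
    and \<delta>_pos: "0 < \<delta>"
begin

text \<open>The space is restricted because \<open>radon_measure_on\<close> prescribes the
  sigma-algebra of the half-line, whereas the density lives on the whole line.\<close>

definition \<nu> :: "real measure" where
  "\<nu> = restrict_space (density lborel (\<lambda>\<tau>. ennreal (f \<tau>))) {0..}"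

lemma sets_\<nu>: "sets \<nu> = sets (restrict_space borel {0..})"
  unfolding \<nu>_def by (rule sets_restrict_space_cong) simp

lemma emeasure_\<nu>:
  assumes "A \<in> sets borel" "A \<subseteq> {0..}"
  shows "emeasure \<nu> A = emeasure (density lborel (\<lambda>\<tau>. ennreal (f \<tau>))) A"
  unfolding \<nu>_def using assms by (subst emeasure_restrict_space) auto

lemma D_nonneg: "0 \<le> D"
  using bound[of 1] nonneg[of 1] by simp

lemma le_D: "f \<tau> \<le> indicator {1..} \<tau> * D"
proof (cases "1 \<le> \<tau>")
  case True
  have "f \<tau> \<le> D * \<tau> powr (-\<delta>)" by (rule bound[OF True])
  also have "\<dots> \<le> D * 1" using True \<delta>_pos D_nonneg
    using powr_mono[of "-\<delta>" 0 \<tau>] by (intro mult_left_mono) simp_all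
  finally show ?thesis using True by simp
qed (simp add: zero)

lemma emeasure_atLeastAtMost_finite: "emeasure (density lborel (\<lambda>\<tau>. ennreal (f \<tau>))) {0..b} < \<infinity>"
proof -
  have "f \<tau> \<le> D" for \<tau>
    using le_D[of \<tau>] D_nonneg by (cases "1 \<le> \<tau>") auto
  then have "emeasure (density lborel (\<lambda>\<tau>. ennreal (f \<tau>))) {0..b} \<le> (\<integral>\<^sup>+\<tau>. ennreal D * indicator {0..b} \<tau> \<partial>lborel)"
    by (subst emeasure_density) (auto intro!: nn_integral_mono mult_right_mono ennreal_leI)
  also have "\<dots> < \<infinity>"
    by (subst nn_integral_cmult_indicator) (auto simp: ennreal_mult_less_top emeasure_lborel_Icc_eq)
  finally show ?thesis .
qed

text \<open>Local finiteness holds because the density is bounded. The total mass may be infinite,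
  whereas \<open>inner_regular\<close> is about finite measures; it is therefore applied to the
  restriction to [0, n], and continuity from below lets n tend to infinity.\<close>

lemma radon: "radon_measure_on {0..} \<nu>"
  unfolding radon_measure_on_def
proof (intro conjI allI impI ballI)
  let ?N = "density lborel (\<lambda>\<tau>. ennreal (f \<tau>))"
  show "sets \<nu> = sets (restrict_space borel {0..})" by (rule sets_\<nu>)
  show "emeasure \<nu> K < \<infinity>" if "K \<subseteq> {0..}" "compact K" for K
  proof -
    obtain b where "\<And>x. x \<in> K \<Longrightarrow> norm x \<le> b"
      using compact_imp_bounded[OF \<open>compact K\<close>] by (auto simp: bounded_iff)
    then have "K \<subseteq> {0..b}" using that by fastforce
    then have "emeasure ?N K \<le> emeasure ?N {0..b}" by (intro emeasure_mono) auto
    then show ?thesis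
      using emeasure_atLeastAtMost_finite[of b] that
      by (simp add: emeasure_\<nu> borel_compact)
  qed
  show "emeasure \<nu> A = (SUP K\<in>{K. K \<subseteq> A \<and> compact K}. emeasure \<nu> K)" if "A \<in> sets \<nu>" for A
  proof (rule antisym)
    have A: "A \<in> sets borel" "A \<subseteq> {0..}"
      using that by (auto simp: sets_\<nu> sets_restrict_space_iff)
    have \<nu>_compact: "emeasure \<nu> K = emeasure ?N K" if "K \<subseteq> A" "compact K" for K
      using that A by (intro emeasure_\<nu>) (auto intro: borel_compact)
    have "emeasure ?N (A \<inter> {0..real n}) \<le> (SUP K\<in>{K. K \<subseteq> A \<and> compact K}. emeasure \<nu> K)" for n
    proof -
      let ?Nn = "density ?N (indicator {0..real n})"
      have em: "emeasure ?Nn B = emeasure ?N ({0..real n} \<inter> B)" if "B \<in> sets borel" for B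
        using that by (intro emeasure_restricted) auto
      have "emeasure ?N (A \<inter> {0..real n}) = emeasure ?Nn A"
        using A by (simp add: em Int_commute)
      also have "\<dots> = (SUP K\<in>{K. K \<subseteq> A \<and> compact K}. emeasure ?Nn K)"
        using A emeasure_atLeastAtMost_finite[of "real n"] em[of UNIV] by (intro inner_regular) auto
      also have "\<dots> \<le> (SUP K\<in>{K. K \<subseteq> A \<and> compact K}. emeasure \<nu> K)"
      proof (rule SUP_least)
        fix K assume K: "K \<in> {K. K \<subseteq> A \<and> compact K}"
        then have "emeasure ?Nn K \<le> emeasure \<nu> K"
          by (auto simp: em \<nu>_compact borel_compact intro!: emeasure_mono)
        then show "emeasure ?Nn K \<le> (SUP K\<in>{K. K \<subseteq> A \<and> compact K}. emeasure \<nu> K)"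
          by (rule SUP_upper2[OF K])
      qed
      finally show ?thesis .
    qed
    moreover have "emeasure \<nu> A = (SUP n. emeasure ?N (A \<inter> {0..real n}))"
    proof -
      have "(\<Union>n. A \<inter> {0..real n}) = A" using A by (auto intro: real_arch_simple)
      moreover have "(SUP n. emeasure ?N (A \<inter> {0..real n})) = emeasure ?N (\<Union>n. A \<inter> {0..real n})"
        using A by (intro SUP_emeasure_incseq) (auto simp: incseq_def)
      ultimately show ?thesis using A by (simp add: emeasure_\<nu>)
    qed
    ultimately show "emeasure \<nu> A \<le> (SUP K\<in>{K. K \<subseteq> A \<and> compact K}. emeasure \<nu> K)"
      by (auto intro: SUP_least)
    show "(SUP K\<in>{K. K \<subseteq> A \<and> compact K}. emeasure \<nu> K) \<le> emeasure \<nu> A"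
      using that by (intro SUP_least) (auto intro: emeasure_mono)
  qed
qed

lemma emeasure_\<nu>_below_1: "emeasure \<nu> {0..<1} = 0"
proof -
  have "emeasure \<nu> {0..<1} = (\<integral>\<^sup>+\<tau>. ennreal (f \<tau>) * indicator {0..<1} \<tau> \<partial>lborel)"
    by (subst emeasure_\<nu>) (auto simp: emeasure_density)
  also have "\<dots> = (\<integral>\<^sup>+\<tau>. 0 \<partial>(lborel :: real measure))"
    by (intro nn_integral_cong) (auto simp: indicator_def zero)
  finally show ?thesis by simp
qed

text \<open>Integrals over the restricted space acquire the indicator of the half-line; the density
  absorbs it.\<close>

lemma indicator_times_f: "f \<tau> * (indicator {0..} \<tau> * y) = f \<tau> * y"
  using zero[of \<tau>] by (auto simp: indicator_def)

lemma
  fixes \<phi> :: "real \<Rightarrow> real"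
  assumes [measurable]: "\<phi> \<in> borel_measurable borel"
  shows integrable_\<nu>_iff: "integrable \<nu> \<phi> \<longleftrightarrow> integrable lborel (\<lambda>\<tau>. f \<tau> * \<phi> \<tau>)"
    and integral_\<nu>: "integral\<^sup>L \<nu> \<phi> = (LINT \<tau>|lborel. f \<tau> * \<phi> \<tau>)"
  by (simp_all add: \<nu>_def integrable_restrict_space integral_restrict_space integrable_density
      integral_density nonneg indicator_times_f)

lemma laplace_\<nu>: "laplace_transform \<nu> t = (LINT \<tau>|lborel. f \<tau> * exp (- (\<tau> * t)))"
  unfolding laplace_transform_def by (rule integral_\<nu>) simp

lemma integrable_laplace:
  assumes "0 < t"
  shows "integrable lborel (\<lambda>\<tau>. f \<tau> * exp (- (\<tau> * t)))"
proof (rule Bochner_Integration.integrable_bound)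
  show "integrable lborel (\<lambda>\<tau>. D * (indicator {1..} \<tau> * exp (- (t * \<tau>))))"
    using integrable_exp_minus_atLeast[OF assms] by simp
  show "AE \<tau> in lborel. norm (f \<tau> * exp (- (\<tau> * t))) \<le> norm (D * (indicator {1..} \<tau> * exp (- (t * \<tau>))))"
  proof (rule AE_I2)
    fix \<tau> :: real
    have "f \<tau> * exp (- (\<tau> * t)) \<le> indicator {1..} \<tau> * D * exp (- (\<tau> * t))"
      by (rule mult_right_mono[OF le_D]) simp
    then show "norm (f \<tau> * exp (- (\<tau> * t))) \<le> norm (D * (indicator {1..} \<tau> * exp (- (t * \<tau>))))"
      using nonneg[of \<tau>] D_nonneg by (simp add: abs_mult mult_ac)
  qed
qed simp

lemma laplace_pos:
  assumes "\<not> (AE \<tau> in lborel. f \<tau> = 0)" "0 < t"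
  shows "0 < laplace_transform \<nu> t"
proof -
  have "laplace_transform \<nu> t \<noteq> 0"
    using assms integral_nonneg_eq_0_iff_AE[OF integrable_laplace[OF assms(2)]] nonneg
    by (auto simp: laplace_\<nu>)
  moreover have "0 \<le> laplace_transform \<nu> t"
    unfolding laplace_\<nu> using nonneg by (intro integral_nonneg_AE) auto
  ultimately show ?thesis by simp
qed

text \<open>The function f \<tau> / \<tau> is the integral of f \<tau> * exp (- (\<tau> * t)) over t
  > 0, so by Tonelli this is the source of the integrability of k.\<close>

lemma integrable_f_over_id: "integrable lborel (\<lambda>\<tau>. f \<tau> / \<tau>)"
proof (rule Bochner_Integration.integrable_bound)
  show "integrable lborel (\<lambda>\<tau>. D * (indicator {1..} \<tau> * \<tau> powr (-\<delta> - 1)))"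
    using integrable_powr_atLeast[of "-\<delta> - 1"] \<delta>_pos by simp
  have "f \<tau> / \<tau> \<le> D * \<tau> powr (-\<delta> - 1)" if "1 \<le> \<tau>" for \<tau>
    using that bound[OF that] by (simp add: powr_diff divide_right_mono)
  then show "AE \<tau> in lborel. norm (f \<tau> / \<tau>) \<le> norm (D * (indicator {1..} \<tau> * \<tau> powr (-\<delta> - 1)))"
    using nonneg D_nonneg zero by (auto simp: indicator_def)
qed simp

text \<open>This licenses Fubini. Bounding the cosine by 1 leaves a nonnegative kernel whose inner
  integral is f \<tau> / \<tau>. For \<tau> <= 0 the exponential is not integrable in t, but there f
  vanishes.\<close>

lemma integrable_product_cos:
  "integrable (lborel \<Otimes>\<^sub>M lborel)
    (\<lambda>(\<tau>, t). f \<tau> * (indicator {0<..} t * (exp (- (\<tau> * t)) * cos (s * t))))"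
proof -
  have i: "has_bochner_integral lborel (\<lambda>t. f \<tau> * (indicator {0<..} t * exp (- (\<tau> * t)))) (f \<tau> / \<tau>)" for \<tau>
  proof (cases "1 \<le> \<tau>")
    case True
    then show ?thesis
      using has_bochner_integral_mult_right[OF has_bochner_integral_exp_cos[of \<tau> 0], of "f \<tau>"]
      by (simp add: power2_eq_square)
  qed (simp add: zero has_bochner_integral_zero)
  have "integrable (lborel \<Otimes>\<^sub>M lborel) (\<lambda>(\<tau>, t). f \<tau> * (indicator {0<..} t * exp (- (\<tau> * t))))"
  proof (rule lborel_pair.Fubini_integrable)
    show "integrable lborel (\<lambda>\<tau>. LINT t|lborel. norm (case (\<tau>, t) of (\<tau>, t) \<Rightarrow>
        f \<tau> * (indicator {0<..} t * exp (- (\<tau> * t)))))"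
      using integrable_f_over_id has_bochner_integral_integral_eq[OF i] nonneg
      by (simp add: abs_mult)
    show "AE \<tau> in lborel. integrable lborel (\<lambda>t. case (\<tau>, t) of (\<tau>, t) \<Rightarrow>
        f \<tau> * (indicator {0<..} t * exp (- (\<tau> * t))))"
      using i by (auto simp: has_bochner_integral_iff)
  qed measurable
  then show ?thesis
  proof (rule Bochner_Integration.integrable_bound)
    have "f \<tau> * (indicator {0<..} t * (exp (- (\<tau> * t)) * \<bar>cos (s * t)\<bar>))
        \<le> f \<tau> * (indicator {0<..} t * exp (- (\<tau> * t)))" for \<tau> t
      using nonneg by (intro mult_left_mono) (auto simp: mult_left_le)
    then show "AE p in lborel \<Otimes>\<^sub>M lborel.
        norm (case p of (\<tau>, t) \<Rightarrow> f \<tau> * (indicator {0<..} t * (exp (- (\<tau> * t)) * cos (s * t))))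
        \<le> norm (case p of (\<tau>, t) \<Rightarrow> f \<tau> * (indicator {0<..} t * exp (- (\<tau> * t))))"
      by (intro AE_I2) (simp add: abs_mult nonneg split: prod.split)
    show "(\<lambda>(\<tau>, t). f \<tau> * (indicator {0<..} t * (exp (- (\<tau> * t)) * cos (s * t))))
        \<in> borel_measurable (lborel \<Otimes>\<^sub>M lborel)"
      unfolding split_beta by (auto intro!: borel_measurable_times borel_measurable_continuous_onI)
  qed
qed

text \<open>The two orders of integration of the same double integral: integrating over \<tau> first
  produces k, integrating over t first produces the kernel \<tau> / (\<tau>^2 + s^2). At s = 0 the
  first claim is the integrability of k itself.\<close>

lemma
  shows integrable_laplace_cos: "integrable lborel (\<lambda>t. indicator {0<..} t * (laplace_transform \<nu> t * cos (s * t)))"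
    and integral_laplace_cos: "(LINT t|lborel. indicator {0<..} t * (laplace_transform \<nu> t * cos (s * t))) =
      (LINT \<tau>|lborel. f \<tau> * (\<tau> / (\<tau>\<^sup>2 + s\<^sup>2)))"
proof -
  have e: "(LINT \<tau>|lborel. f \<tau> * (indicator {0<..} t * (exp (- (\<tau> * t)) * cos (s * t)))) =
      indicator {0<..} t * (laplace_transform \<nu> t * cos (s * t))" for t
  proof -
    have "(LINT \<tau>|lborel. f \<tau> * (indicator {0<..} t * (exp (- (\<tau> * t)) * cos (s * t)))) =
        (LINT \<tau>|lborel. (indicator {0<..} t * cos (s * t)) * (f \<tau> * exp (- (\<tau> * t))))"
      by (rule Bochner_Integration.integral_cong) (simp_all only: mult_ac)
    then show ?thesis by (simp add: laplace_\<nu>)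
  qed
  have e': "(LINT t|lborel. f \<tau> * (indicator {0<..} t * (exp (- (\<tau> * t)) * cos (s * t)))) =
      f \<tau> * (\<tau> / (\<tau>\<^sup>2 + s\<^sup>2))" for \<tau>
  proof (cases "1 \<le> \<tau>")
    case True
    then show ?thesis
      using has_bochner_integral_mult_right[OF has_bochner_integral_exp_cos[of \<tau> s], of "f \<tau>"]
      by (simp add: has_bochner_integral_iff)
  qed (simp add: zero)
  show "integrable lborel (\<lambda>t. indicator {0<..} t * (laplace_transform \<nu> t * cos (s * t)))"
    using lborel_pair.integrable_snd[OF integrable_product_cos[of s]] by (simp only: e)
  show "(LINT t|lborel. indicator {0<..} t * (laplace_transform \<nu> t * cos (s * t))) =
      (LINT \<tau>|lborel. f \<tau> * (\<tau> / (\<tau>\<^sup>2 + s\<^sup>2)))"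
    using lborel_pair.Fubini_integral[OF integrable_product_cos[of s]] by (simp only: e e')
qed

lemma set_integrable_laplace: "set_integrable lborel {0<..} (laplace_transform \<nu>)"
  using integrable_laplace_cos[of 0] by (simp add: set_integrable_def)

lemma Re_fourier:
  "Re (fourier_transform (\<lambda>t. if 0 < t then laplace_transform \<nu> t else 0) s) =
    (LINT \<tau>|lborel. f \<tau> * (\<tau> / (\<tau>\<^sup>2 + s\<^sup>2)))"
proof -
  define k where "k t = (if 0 < t then laplace_transform \<nu> t else 0)" for t
  have k: "k = (\<lambda>t. indicator {0<..} t * laplace_transform \<nu> t)"
    by (auto simp: k_def indicator_def)
  have int: "integrable lborel k"
    using set_integrable_laplace by (simp add: set_integrable_def k)
  then have [measurable]: "k \<in> borel_measurable borel"
    using borel_measurable_integrable by fastforce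
  have [measurable]: "(\<lambda>t. exp (- (\<i> * complex_of_real (s * t)))) \<in> borel_measurable borel"
    by (intro borel_measurable_continuous_onI continuous_intros)
  have "integrable lborel (\<lambda>t. exp (- (\<i> * complex_of_real (s * t))) * complex_of_real (k t))"
    by (rule Bochner_Integration.integrable_bound[OF int]) (measurable, simp add: norm_mult)
  then have "Re (fourier_transform k s) =
      (LINT t|lborel. Re (exp (- (\<i> * complex_of_real (s * t))) * complex_of_real (k t)))"
    unfolding fourier_transform_def by (rule integral_Re[symmetric])
  also have "\<dots> = (LINT t|lborel. indicator {0<..} t * (laplace_transform \<nu> t * cos (s * t)))"
    by (simp add: Re_exp k mult_ac)
  finally show ?thesis using integral_laplace_cos[of s] unfolding k_def by simp
qed

end

section \<open>The limit kernel, and Borel versions of Lebesgue measurable densities\<close>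

text \<open>The kernel behaves like u^p at 0 and like u^(p - 2) at infinity. It is used for the
  limit, p = 1 - \<alpha>, and for the majorants, p = 1 - \<alpha> - \<epsilon> and p = 1 - \<alpha>
  + \<epsilon>.\<close>

lemma integrable_powr_over_1_plus_square:
  fixes p :: real
  assumes "-1 < p" "p < 1"
  shows "integrable lborel (\<lambda>u. indicator {0<..} u * (u powr p / (1 + u\<^sup>2)))"
proof (rule Bochner_Integration.integrable_bound)
  show "integrable lborel (\<lambda>u. indicator {0<..1} u * u powr p + indicator {1..} u * u powr (p - 2))"
    using assms by (intro Bochner_Integration.integrable_add integrable_powr_Ioc integrable_powr_atLeast) auto
  have small: "u powr p / (1 + u\<^sup>2) \<le> u powr p" for u :: real
    by (simp add: divide_le_eq_1 mult_le_cancel_left1 add_pos_nonneg divide_le_eq)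
  have large: "u powr p / (1 + u\<^sup>2) \<le> u powr (p - 2)" if "0 < u" for u :: real
    using that by (auto simp: powr_diff intro!: divide_left_mono mult_pos_pos add_pos_nonneg)
  show "AE u in lborel. norm (indicator {0<..} u * (u powr p / (1 + u\<^sup>2)))
      \<le> norm (indicator {0<..1} u * u powr p + indicator {1..} u * u powr (p - 2))"
  proof (rule AE_I2)
    fix u :: real
    consider "u \<le> 0" | "0 < u" "u < 1" | "u = 1" | "1 < u" by linarith
    then show "norm (indicator {0<..} u * (u powr p / (1 + u\<^sup>2)))
      \<le> norm (indicator {0<..1} u * u powr p + indicator {1..} u * u powr (p - 2))"
      using small[of u] large[of u] by cases auto
  qed
qed measurable

text \<open>Clamping an arbitrary Borel version between l and b changes it only on a null set and
  makes the bounds hold everywhere, as the assumptions of \<open>decaying_density\<close>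
  demand.\<close>

lemma ex_borel_AE_eq_between:
  fixes f :: "'a \<Rightarrow> real"
  assumes "f \<in> borel_measurable (completion N)"
    and [measurable]: "l \<in> borel_measurable N" "b \<in> borel_measurable N"
    and "\<And>x. l x \<le> f x" "\<And>x. f x \<le> b x"
  obtains g where "g \<in> borel_measurable N" "AE x in N. f x = g x"
    "\<And>x. l x \<le> g x" "\<And>x. g x \<le> b x"
proof -
  obtain h where h[measurable]: "h \<in> borel_measurable N" and ae: "AE x in N. f x = h x"
    using completion_ex_borel_measurable_real[OF assms(1)] by blast
  show ?thesis
  proof
    show "(\<lambda>x. max (l x) (min (b x) (h x))) \<in> borel_measurable N" by measurable
    show "AE x in N. f x = max (l x) (min (b x) (h x))"
      using ae
    proof eventually_elim
      case (elim x)
      then show ?case using assms(4)[of x] assms(5)[of x] by simp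
    qed
    show "l x \<le> max (l x) (min (b x) (h x))" for x by simp
    show "max (l x) (min (b x) (h x)) \<le> b x" for x
      using order_trans[OF assms(4,5)] by simp
  qed
qed

lemma borel_measurable_lebesgue_cutoff:
  fixes G :: "real \<Rightarrow> real"
  assumes G: "G \<in> borel_measurable lebesgue"
  shows "(\<lambda>\<tau>. if X \<le> \<tau> then 1 / (G \<tau> * \<tau> powr \<alpha>) else 0) \<in> borel_measurable lebesgue"
proof -
  have p: "(\<lambda>\<tau>. indicator {X..} \<tau> / \<tau> powr \<alpha>) \<in> borel_measurable lebesgue"
    by (rule measurable_completion) measurable
  have "(\<lambda>\<tau>. indicator {X..} \<tau> / \<tau> powr \<alpha> / G \<tau>) \<in> borel_measurable lebesgue"
    by (rule borel_measurable_divide[OF p G])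
  also have "(\<lambda>\<tau>. indicator {X..} \<tau> / \<tau> powr \<alpha> / G \<tau>) =
      (\<lambda>\<tau>. if X \<le> \<tau> then 1 / (G \<tau> * \<tau> powr \<alpha>) else 0)"
    by (auto simp: mult.commute)
  finally show ?thesis .
qed

text \<open>Used to see that a function that is nonzero on an interval is not null: once for I > 0,
  once for the positivity of k.\<close>

lemma not_AE_notin_Icc:
  fixes a b :: real
  assumes "a < b"
  shows "\<not> (AE x in lborel. x \<notin> {a..b})"
proof
  assume "AE x in lborel. x \<notin> {a..b}"
  then have "emeasure lborel {a..b} = 0"
    by (subst (asm) AE_iff_measurable[of "{a..b}"]) auto
  then show False using assms by simp
qed

section \<open>Stieltjes-type integrals of slowly varying functions\<close>

text \<open>Dominated convergence after \<tau> = s u. The Borel function f carries the measure, but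
  its values at single points mean nothing; only the exact expression \<open>f0\<close> has the
  ratio G s / G (s u) as a factor at every point, so f is exchanged for \<open>f0\<close> before the
  limit is taken.\<close>

lemma slowly_varying_stieltjes_asymptotics:
  fixes G f :: "real \<Rightarrow> real" and \<alpha> \<epsilon> X :: real
  assumes \<alpha>: "0 < \<alpha>" "\<alpha> < 2"
    and G[measurable]: "G \<in> borel_measurable lebesgue"
    and pos: "\<And>x. 0 < G x"
    and lim: "\<And>c. 1 \<le> c \<Longrightarrow> ((\<lambda>s. G (c * s) / G s) \<longlongrightarrow> 1) at_top"
    and \<epsilon>: "0 < \<epsilon>" "\<epsilon> < \<alpha>" "\<epsilon> < 2 - \<alpha>"
    and X: "1 \<le> X"
    and potter: "\<And>s u. X \<le> s \<Longrightarrow> 1 \<le> u \<Longrightarrow> G (u * s) / G s \<le> 4 * u powr \<epsilon> \<and> G s / G (u * s) \<le> 4 * u powr \<epsilon>"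
    and f[measurable]: "f \<in> borel_measurable borel"
    and f_eq: "AE \<tau> in lborel. (if X \<le> \<tau> then 1 / (G \<tau> * \<tau> powr \<alpha>) else 0) = f \<tau>"
  shows "((\<lambda>s. (LINT \<tau>|lborel. f \<tau> * (\<tau> / (\<tau>\<^sup>2 + s\<^sup>2))) * (G s * s powr \<alpha>)) \<longlongrightarrow>
      (LINT u|lborel. indicator {0<..} u * (u powr (1 - \<alpha>) / (1 + u\<^sup>2)))) at_top"
proof -
  define f0 where "f0 \<tau> = (if X \<le> \<tau> then 1 / (G \<tau> * \<tau> powr \<alpha>) else 0)" for \<tau>
  \<comment> \<open>\<open>K s\<close> is the integrand in the variable u, already multiplied by G s
    * s powr \<alpha>. \<open>W p\<close> is the kernel that gives both the limit and the
    majorants.\<close>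
  define K where "K s u = f0 (s * u) * (u / (1 + u\<^sup>2)) * (G s * s powr \<alpha>)" for s u
  define W where "W p u = (indicator {0<..} u * (u powr p / (1 + u\<^sup>2)) :: real)" for p u
  have f0_meas: "f0 \<in> borel_measurable lebesgue"
    unfolding f0_def by (rule borel_measurable_lebesgue_cutoff[OF G])
  have f0_kernel_meas: "(\<lambda>u. f0 (s * u) * (u / (1 + u\<^sup>2))) \<in> borel_measurable lebesgue" for s
    by (rule borel_measurable_times[OF borel_measurable_lebesgue_scale[OF f0_meas] measurable_completion])
       measurable
  have K_meas: "K s \<in> borel_measurable lebesgue" for s
    unfolding K_def by (rule borel_measurable_times[OF f0_kernel_meas borel_measurable_const])
  have W_int: "integrable lborel (W p)" if "-1 < p" "p < 1" for p
    using integrable_powr_over_1_plus_square[OF that] unfolding W_def .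
  have W_meas[measurable]: "W p \<in> borel_measurable borel" for p
    unfolding W_def by measurable
  have K_eq: "K s u = W (1 - \<alpha>) u * (G s / G (s * u))" if "0 < s" "X \<le> s * u" for s u
  proof -
    have "0 < u" using that X by (metis less_le_trans zero_less_mult_pos zero_less_one)
    then show ?thesis using that
      by (simp add: K_def f0_def W_def powr_mult powr_diff mult_ac)
  qed
  have int_eq: "(LINT \<tau>|lborel. f \<tau> * (\<tau> / (\<tau>\<^sup>2 + s\<^sup>2))) * (G s * s powr \<alpha>) = integral\<^sup>L lebesgue (K s)"
    if s: "0 < s" for s
  proof -
    have "(LINT \<tau>|lborel. f \<tau> * (\<tau> / (\<tau>\<^sup>2 + s\<^sup>2))) =
        s * (LINT u|lborel. f (s * u) * ((s * u) / ((s * u)\<^sup>2 + s\<^sup>2)))"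
      using s lborel_integral_real_affine[of s "\<lambda>\<tau>. f \<tau> * (\<tau> / (\<tau>\<^sup>2 + s\<^sup>2))" 0] by simp
    also have "\<dots> = (LINT u|lborel. f (s * u) * (u / (1 + u\<^sup>2)))"
    proof -
      have "s * (f (s * u) * ((s * u) / ((s * u)\<^sup>2 + s\<^sup>2))) = f (s * u) * (u / (1 + u\<^sup>2))" for u
      proof -
        have "(s * u)\<^sup>2 + s\<^sup>2 = s * s * (1 + u\<^sup>2)" by (simp add: power2_eq_square algebra_simps)
        then show ?thesis using s by simp
      qed
      then show ?thesis by (simp flip: integral_mult_right_zero)
    qed
    also have "\<dots> = (LINT u|lebesgue. f (s * u) * (u / (1 + u\<^sup>2)))"
      by (rule integral_completion[symmetric]) measurable
    also have "\<dots> = (LINT u|lebesgue. f0 (s * u) * (u / (1 + u\<^sup>2)))"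
    proof (rule integral_cong_AE)
      show "(\<lambda>u. f (s * u) * (u / (1 + u\<^sup>2))) \<in> borel_measurable lebesgue"
        by (rule measurable_completion) simp
      show "(\<lambda>u. f0 (s * u) * (u / (1 + u\<^sup>2))) \<in> borel_measurable lebesgue"
        by (rule f0_kernel_meas)
      \<comment> \<open>The set where \<open>f0\<close> and f differ need not be Borel, so it is
        enclosed in a Borel null set before the null set is transported along u |-> s u.\<close>
      obtain N where N: "{x \<in> space lborel. \<not> f0 x = f x} \<subseteq> N" "emeasure lborel N = 0" "N \<in> sets lborel"
        using AE_E[OF f_eq[folded f0_def]] by blast
      have off_N: "f0 x = f x" if "x \<notin> N" for x
        using N(1) that by auto
      have "AE x in lborel. x \<notin> N"
        using N by (intro AE_not_in) (auto simp: null_sets_def)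
      then have "AE u in lborel. 0 + s * u \<notin> N"
        using s N(3) by (intro AE_borel_affine) auto
      then show "AE u in lebesgue. f (s * u) * (u / (1 + u\<^sup>2)) = f0 (s * u) * (u / (1 + u\<^sup>2))"
        by (intro AE_completion, eventually_elim) (simp add: off_N)
    qed
    finally show ?thesis unfolding K_def by (simp only: integral_mult_left_zero)
  qed
  have "((\<lambda>s. integral\<^sup>L lebesgue (K s)) \<longlongrightarrow> integral\<^sup>L lebesgue (W (1 - \<alpha>))) at_top"
  proof (rule integral_dominated_convergence_at_top)
    show "integrable lebesgue (\<lambda>u. 4 * W (1 - \<alpha> - \<epsilon>) u + 4 * W (1 - \<alpha> + \<epsilon>) u)"
      using \<alpha> \<epsilon> W_int[of "1 - \<alpha> - \<epsilon>"] W_int[of "1 - \<alpha> + \<epsilon>"]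
      by (subst integrable_completion) auto
    show "AE u in lebesgue. ((\<lambda>s. K s u) \<longlongrightarrow> W (1 - \<alpha>) u) at_top"
    proof (rule AE_I2)
      fix u :: real
      show "((\<lambda>s. K s u) \<longlongrightarrow> W (1 - \<alpha>) u) at_top"
      proof (cases "0 < u")
        case False
        have "\<forall>\<^sub>F s in at_top. K s u = 0" using eventually_gt_at_top[of 0]
        proof eventually_elim
          case (elim s)
          then have "s * u \<le> 0" using False by (simp add: mult_le_0_iff)
          then show ?case using X by (simp add: K_def f0_def)
        qed
        then show ?thesis using False by (simp add: W_def tendsto_eventually)
      next
        case True
        have "((\<lambda>s. G s / G (s * u)) \<longlongrightarrow> 1) at_top"
        proof (cases "1 \<le> u")
          case True
          have "((\<lambda>s. inverse (G (u * s) / G s)) \<longlongrightarrow> inverse 1) at_top"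
            by (intro tendsto_inverse lim True) simp
          then show ?thesis by (simp add: mult.commute)
        next
          case False
          \<comment> \<open>The limit is assumed only for factors at least 1, so for u < 1 the
            factor 1/u is used along the points u s.\<close>
          have "((\<lambda>s. G (1/u * s) / G s) \<longlongrightarrow> 1) at_top" using False \<open>0 < u\<close> by (intro lim) simp
          moreover have "filterlim (\<lambda>s. u * s) at_top at_top"
            using \<open>0 < u\<close> by (intro filterlim_tendsto_pos_mult_at_top[OF tendsto_const]) (auto simp: filterlim_ident)
          ultimately have "((\<lambda>s. G (1/u * (u * s)) / G (u * s)) \<longlongrightarrow> 1) at_top"
            by (rule filterlim_compose)
          then show ?thesis using \<open>0 < u\<close> by (simp add: mult.commute)
        qed
        then have "((\<lambda>s. W (1 - \<alpha>) u * (G s / G (s * u))) \<longlongrightarrow> W (1 - \<alpha>) u * 1) at_top"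
          by (intro tendsto_mult tendsto_const)
        moreover have "\<forall>\<^sub>F s in at_top. W (1 - \<alpha>) u * (G s / G (s * u)) = K s u"
          using eventually_gt_at_top[of 0] eventually_ge_at_top[of "X / u"]
        proof eventually_elim
          case (elim s)
          then show ?case using True by (subst K_eq) (auto simp: field_simps)
        qed
        ultimately show ?thesis by (simp add: tendsto_cong)
      qed
    qed
    show "\<forall>\<^sub>F s in at_top. AE u in lebesgue. norm (K s u) \<le> 4 * W (1 - \<alpha> - \<epsilon>) u + 4 * W (1 - \<alpha> + \<epsilon>) u"
      using eventually_ge_at_top[of X]
    proof (eventually_elim, intro AE_I2)
      fix s u :: real assume s: "X \<le> s"
      have nn: "0 \<le> W p u" for p by (simp add: W_def)
      show "norm (K s u) \<le> 4 * W (1 - \<alpha> - \<epsilon>) u + 4 * W (1 - \<alpha> + \<epsilon>) u"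
      proof (cases "X \<le> s * u")
        case False
        then show ?thesis using nn by (simp add: K_def f0_def)
      next
        case True
        have s0: "0 < s" using s X by simp
        then have u: "0 < u" using True X by (metis less_le_trans zero_less_mult_pos zero_less_one)
        have W: "W (1 - \<alpha>) u * u powr e = W (1 - \<alpha> + e) u" for e
          using u by (simp add: W_def powr_add)
        have "norm (K s u) = W (1 - \<alpha>) u * (G s / G (s * u))"
          using pos[of s] pos[of "s * u"] nn by (simp add: K_eq[OF s0 True])
        \<comment> \<open>The sum of the two powers covers u >= 1 and u < 1 at once; multiplying by
          \<open>W (1 - \<alpha>)\<close> merely shifts the exponent.\<close>
        also have "\<dots> \<le> W (1 - \<alpha>) u * (4 * u powr (-\<epsilon>) + 4 * u powr \<epsilon>)"
        proof (rule mult_left_mono[OF _ nn])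
          show "G s / G (s * u) \<le> 4 * u powr (-\<epsilon>) + 4 * u powr \<epsilon>"
          proof (cases "1 \<le> u")
            case True
            have "G s / G (s * u) \<le> 4 * u powr \<epsilon>" using potter[OF s True] by (simp add: mult.commute)
            then show ?thesis by (simp add: add_increasing)
          next
            case False
            \<comment> \<open>Potter's bound with base point s u and factor 1/u. The base point is
              admissible because s u >= X, the only region where \<open>f0\<close> is
              nonzero.\<close>
            have "G (1/u * (s * u)) / G (s * u) \<le> 4 * (1/u) powr \<epsilon>"
              using potter[OF True, of "1/u"] False u by simp
            then show ?thesis using u by (simp add: powr_divide powr_minus_divide add_increasing2)
          qed
        qed
        also have "\<dots> = 4 * W (1 - \<alpha> - \<epsilon>) u + 4 * W (1 - \<alpha> + \<epsilon>) u"
          using W[of "-\<epsilon>"] W[of \<epsilon>] by (simp add: algebra_simps)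
        finally show ?thesis .
      qed
    qed
  qed (auto intro: measurable_completion K_meas)
  also have "integral\<^sup>L lebesgue (W (1 - \<alpha>)) = integral\<^sup>L lborel (W (1 - \<alpha>))"
    by (rule integral_completion) simp
  finally have "((\<lambda>s. integral\<^sup>L lebesgue (K s)) \<longlongrightarrow> integral\<^sup>L lborel (W (1 - \<alpha>))) at_top" .
  moreover have "\<forall>\<^sub>F s in at_top. integral\<^sup>L lebesgue (K s) =
      (LINT \<tau>|lborel. f \<tau> * (\<tau> / (\<tau>\<^sup>2 + s\<^sup>2))) * (G s * s powr \<alpha>)"
    using eventually_gt_at_top[of 0] by eventually_elim (rule int_eq[symmetric])
  ultimately show ?thesis unfolding W_def by (rule Lim_transform_eventually)
qed

section \<open>Construction of the measure for a given M\<close>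

theorem proposition5p5:
  fixes \<alpha> :: real and M :: "real \<Rightarrow> real"
  assumes "0 < \<alpha>" and "\<alpha> < 2"
    and "regularly_varying 0 \<alpha> M"
  shows "\<exists>\<nu> :: real measure.
    radon_measure_on {0..} \<nu> \<and>
    emeasure \<nu> {0..<1} = 0 \<and>
    (\<forall>t>0. integrable \<nu> (\<lambda>\<tau>. exp (- (\<tau> * t))) \<and> 0 < laplace_transform \<nu> t) \<and>
    set_integrable lborel {0<..} (laplace_transform \<nu>) \<and>
    (\<lambda>s. Re (fourier_transform (\<lambda>t. if 0 < t then laplace_transform \<nu> t else 0) s))
      \<sim>[at_top] (\<lambda>s. 1 / M s)"
proof -
  have M_meas: "M \<in> borel_measurable (lebesgue_on {0..})"
    and M_pos: "\<And>s. 0 \<le> s \<Longrightarrow> 0 < M s"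
    and M_lim: "\<And>c. 1 \<le> c \<Longrightarrow> ((\<lambda>s. M (c * s) / M s) \<longlongrightarrow> c powr \<alpha>) at_top"
    using assms(3) by (auto simp: regularly_varying_def)
  \<comment> \<open>Nothing is assumed about M on negative arguments, and at 0 the quotient would be
    0 because division by 0 gives 0. The value 1 keeps G positive and measurable on the whole
    line.\<close>
  define G where "G x = (if 0 < x then M x / x powr \<alpha> else 1)" for x
  have M_eq: "M s = G s * s powr \<alpha>" if "0 < s" for s
    using that by (simp add: G_def)
  have G_pos: "0 < G x" for x
    using M_pos[of x] by (simp add: G_def)
  have G_meas: "G \<in> borel_measurable lebesgue"
  proof -
    have M': "(\<lambda>x. if x \<in> {0..} then M x else 0) \<in> borel_measurable lebesgue"
      by (rule borel_measurable_if_I[OF M_meas]) simp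
    have p: "(\<lambda>x. x powr \<alpha>) \<in> borel_measurable lebesgue"
      by (rule measurable_completion) simp
    have i: "(indicator A :: real \<Rightarrow> real) \<in> borel_measurable lebesgue" if "A \<in> sets borel" for A
      by (rule measurable_completion) (use that in simp)
    have "(\<lambda>x. indicator {0<..} x * ((if x \<in> {0..} then M x else 0) / x powr \<alpha>) + indicator {..0} x)
        \<in> borel_measurable lebesgue"
      by (rule borel_measurable_add[OF borel_measurable_times[OF i borel_measurable_divide[OF M' p]] i]) simp_all
    also have "(\<lambda>x. indicator {0<..} x * ((if x \<in> {0..} then M x else 0) / x powr \<alpha>) + indicator {..0} x) = G"
      by (auto simp: G_def)
    finally show ?thesis .
  qed
  have G_lim: "((\<lambda>s. G (c * s) / G s) \<longlongrightarrow> 1) at_top" if c: "1 \<le> c" for c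
  proof -
    have "((\<lambda>s. M (c * s) / M s / c powr \<alpha>) \<longlongrightarrow> c powr \<alpha> / c powr \<alpha>) at_top"
      using c by (intro tendsto_divide M_lim tendsto_const) auto
    moreover have "\<forall>\<^sub>F s in at_top. M (c * s) / M s / c powr \<alpha> = G (c * s) / G s"
      using eventually_gt_at_top[of 0]
      by eventually_elim (use c in \<open>simp add: G_def powr_mult\<close>)
    ultimately show ?thesis using c by (simp add: tendsto_cong)
  qed
  \<comment> \<open>Being below \<alpha> and 2 - \<alpha>, this \<epsilon> keeps the exponents 1 -
    \<alpha> - \<epsilon> and 1 - \<alpha> + \<epsilon> inside (-1, 1) and the decay rate \<alpha> -
    \<epsilon> of the density positive.\<close>
  define \<epsilon> where "\<epsilon> = min \<alpha> (2 - \<alpha>) / 2"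
  have \<epsilon>: "0 < \<epsilon>" "\<epsilon> < \<alpha>" "\<epsilon> < 2 - \<alpha>"
    using assms(1,2) by (auto simp: \<epsilon>_def min_def)
  obtain X where X: "1 \<le> X"
    and potter: "\<And>s u. X \<le> s \<Longrightarrow> 1 \<le> u \<Longrightarrow> G (u * s) / G s \<le> 4 * u powr \<epsilon> \<and> G s / G (u * s) \<le> 4 * u powr \<epsilon>"
    using potter_bounds[OF G_meas G_pos G_lim \<epsilon>(1)] by blast
  define I where "I = (LINT u|lborel. indicator {0<..} u * (u powr (1 - \<alpha>) / (1 + u\<^sup>2)))"
  have "0 < I"
  proof -
    let ?w = "\<lambda>u. indicator {0<..} u * (u powr (1 - \<alpha>) / (1 + u\<^sup>2)) :: real"
    have nn: "AE u in lborel. 0 \<le> ?w u" by simp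
    have "\<not> (AE u in lborel. ?w u = 0)"
    proof
      assume "AE u in lborel. ?w u = 0"
      then have "AE u in lborel. u \<notin> {1..2::real}"
      proof eventually_elim
        case (elim u)
        have "1 + u\<^sup>2 \<noteq> 0" using zero_le_power2[of u] by linarith
        with elim show ?case by auto
      qed
      then show False using not_AE_notin_Icc[of 1 2] by simp
    qed
    then have "I \<noteq> 0"
      using integral_nonneg_eq_0_iff_AE[OF integrable_powr_over_1_plus_square[of "1 - \<alpha>"] nn] assms(1,2)
      by (auto simp: I_def)
    moreover have "0 \<le> I" unfolding I_def by (rule integral_nonneg_AE[OF nn])
    ultimately show ?thesis by simp
  qed
  \<comment> \<open>Potter's bound from the base point X with factor \<tau> / X reads 1 / G \<tau>
    <= 4 (\<tau> / X)^\<epsilon> / G X, and D collects what does not depend on \<tau>.\<close>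
  define D where "D = 4 * X powr (-\<epsilon>) / G X"
  have D: "0 \<le> D" using G_pos[of X] by (simp add: D_def)
  define f0 where "f0 \<tau> = (if X \<le> \<tau> then 1 / (G \<tau> * \<tau> powr \<alpha>) else 0)" for \<tau>
  \<comment> \<open>The indicator in the upper bound forces the Borel version f to vanish at every
    point below X, not just almost everywhere; since X >= 1, it vanishes below 1.\<close>
  define b where "b \<tau> = indicator {X..} \<tau> * (D * \<tau> powr (- (\<alpha> - \<epsilon>)))" for \<tau>
  have f0_le: "f0 \<tau> \<le> b \<tau>" for \<tau>
  proof (cases "X \<le> \<tau>")
    case True
    have t0: "0 < \<tau>" using True X by simp
    have "G X / G (\<tau> / X * X) \<le> 4 * (\<tau> / X) powr \<epsilon>"
      using potter[of X "\<tau> / X"] True X by simp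
    then have "1 / G \<tau> \<le> D * \<tau> powr \<epsilon>"
      using X t0 G_pos[of X] by (simp add: D_def powr_divide powr_minus field_simps)
    then have "1 / G \<tau> * \<tau> powr (-\<alpha>) \<le> D * \<tau> powr \<epsilon> * \<tau> powr (-\<alpha>)"
      by (rule mult_right_mono) simp
    also have "D * \<tau> powr \<epsilon> * \<tau> powr (-\<alpha>) = D * \<tau> powr (- (\<alpha> - \<epsilon>))"
      by (simp add: powr_add[symmetric])
    finally show ?thesis using True by (simp add: f0_def b_def powr_minus_divide)
  qed (simp add: f0_def b_def)
  have f0_meas: "f0 \<in> borel_measurable lebesgue"
    unfolding f0_def by (rule borel_measurable_lebesgue_cutoff[OF G_meas])
  \<comment> \<open>A density of a Borel measure has to be Borel, while \<open>M\<close> is only Lebesgue measurable.\<close>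
  obtain f where f[measurable]: "f \<in> borel_measurable borel" and f_ae: "AE \<tau> in lborel. f0 \<tau> = f \<tau>"
    and f_nonneg: "\<And>\<tau>. 0 \<le> f \<tau>" and f_le: "\<And>\<tau>. f \<tau> \<le> b \<tau>"
  proof (rule ex_borel_AE_eq_between[of f0 lborel "\<lambda>_. 0" b])
    show "0 \<le> f0 \<tau>" for \<tau> using G_pos[of \<tau>] by (simp add: f0_def)
    show "b \<in> borel_measurable lborel" unfolding b_def[abs_def] by measurable
  qed (use f0_meas f0_le in auto)
  interpret decaying_density "\<lambda>\<tau>. f \<tau> / I" "D / I" "\<alpha> - \<epsilon>"
  proof
    show "f \<tau> / I = 0" if "\<tau> < 1" for \<tau>
      using f_nonneg[of \<tau>] f_le[of \<tau>] that X by (simp add: b_def)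
    show "f \<tau> / I \<le> D / I * \<tau> powr (- (\<alpha> - \<epsilon>))" if "1 \<le> \<tau>" for \<tau>
    proof -
      have "f \<tau> \<le> D * \<tau> powr (- (\<alpha> - \<epsilon>))"
        by (rule order_trans[OF f_le]) (simp add: b_def D indicator_def)
      from divide_right_mono[OF this, of I] show ?thesis using \<open>0 < I\<close> by simp
    qed
  qed (use \<open>0 < I\<close> f_nonneg \<epsilon> in auto)
  have not_null: "\<not> (AE \<tau> in lborel. f \<tau> / I = 0)"
  proof
    assume "AE \<tau> in lborel. f \<tau> / I = 0"
    then have "AE \<tau> in lborel. \<tau> \<notin> {X..X + 1}"
      using f_ae
    proof eventually_elim
      case (elim \<tau>)
      then show ?case using G_pos[of \<tau>] X \<open>0 < I\<close> by (auto simp: f0_def)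
    qed
    then show False using not_AE_notin_Icc[of X "X + 1"] by simp
  qed
  have "((\<lambda>s. (LINT \<tau>|lborel. f \<tau> * (\<tau> / (\<tau>\<^sup>2 + s\<^sup>2))) * (G s * s powr \<alpha>)) \<longlongrightarrow> I) at_top"
    unfolding I_def
    by (rule slowly_varying_stieltjes_asymptotics[OF assms(1,2) G_meas G_pos G_lim \<epsilon> X potter f f_ae[unfolded f0_def]])
  then have "((\<lambda>s. (LINT \<tau>|lborel. f \<tau> * (\<tau> / (\<tau>\<^sup>2 + s\<^sup>2))) * (G s * s powr \<alpha>) / I) \<longlongrightarrow> I / I) at_top"
    using \<open>0 < I\<close> by (intro tendsto_divide tendsto_const) auto
  moreover have "\<forall>\<^sub>F s in at_top. (LINT \<tau>|lborel. f \<tau> * (\<tau> / (\<tau>\<^sup>2 + s\<^sup>2))) * (G s * s powr \<alpha>) / I =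
      Re (fourier_transform (\<lambda>t. if 0 < t then laplace_transform \<nu> t else 0) s) / (1 / M s)"
    using eventually_gt_at_top[of 0]
  proof eventually_elim
    case (elim s)
    have "(LINT \<tau>|lborel. f \<tau> / I * (\<tau> / (\<tau>\<^sup>2 + s\<^sup>2))) = (LINT \<tau>|lborel. f \<tau> * (\<tau> / (\<tau>\<^sup>2 + s\<^sup>2))) / I"
      by (simp flip: integral_divide_zero add: mult_ac)
    then show ?case by (simp add: Re_fourier M_eq[OF elim])
  qed
  ultimately have "((\<lambda>s. Re (fourier_transform (\<lambda>t. if 0 < t then laplace_transform \<nu> t else 0) s) / (1 / M s))
      \<longlongrightarrow> 1) at_top"
    using \<open>0 < I\<close> by (simp add: tendsto_cong)
  then have "(\<lambda>s. Re (fourier_transform (\<lambda>t. if 0 < t then laplace_transform \<nu> t else 0) s))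
      \<sim>[at_top] (\<lambda>s. 1 / M s)"
    by (rule asymp_equivI')
  moreover have "integrable \<nu> (\<lambda>\<tau>. exp (- (\<tau> * t)))" if "0 < t" for t
    using integrable_laplace[OF that] by (simp add: integrable_\<nu>_iff)
  ultimately show ?thesis
    using radon emeasure_\<nu>_below_1 laplace_pos[OF not_null] set_integrable_laplace
    by (intro exI[of _ \<nu>]) auto
qed

end
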